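(* Let $X_i\in\mathscr{M}_r$, $\Delta t\in\mathbb{R}$, $k\ge1$, and $\overline{L}^{(1)},\dots,\overline{L}^{(k)}\in\mathbb{R}^{m\times n}$, with $\overline{L}=\overline{L}^{(k)}$. Starting from $X_i$, let $X_{i+1}$ be the result of integrating $\Delta t\,\overline{L}$ with a gd-DORK (gradient-descent Dynamically Orthogonal Runge-Kutta) scheme in which the final inner retraction is an optimal perturbative retraction $\mathcal{R}^{\mathrm{opt}}$ (of any order $p\in\{1,2,3,4\}$). Then $$\|X_{i+1}\|\le\|X_i+\Delta t\,\overline{L}\|.$$
   Context: $\|\cdot\|$ is the Frobenius norm and $\mathscr{M}_r$ is the manifold of rank-$r$ real $m\times n$ matrices. A retraction maps a point $X\in\mathscr{M}_r$ and an increment $D\in\mathbb{R}^{m\times n}$ to a point $\mathcal{R}_X(D)$ of $\mathscr{M}_r$. The matrix $\overline{L}^{(j)}$ is the time-averaged increment given by a $j$-th order integration scheme for the differential operator. gd-DORK scheme: set $X^{(0)}=X_i$ and, for $j=1,\dots,k$, $$X^{(j)}=\mathcal{R}_{X^{(j-1)}}\big(\Delta t\,\overline{L}^{(j)}-(X^{(j-1)}-X_i)\big),$$ where $\mathcal{R}$ is the inner retraction used at step $j$; the output is $X_{i+1}=X^{(k)}$. The iterates at which an inner retraction is based are taken to lie in $\mathscr{M}_r$, so that each step is well defined. Optimal perturbative retraction of order $p$: for $X=UZ^T\in\mathscr{M}_r$ with $U\in\mathbb{R}^{m\times r}$, $U^TU=I$, $Z\in\mathbb{R}^{n\times r}$ of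 rank $r$, and $D\in\mathbb{R}^{m\times n}$, put $P^\perp=I-UU^T$ and $$W_1 = P^\perp DZ(Z^TZ)^{-1},$$ $$W_2 = \left[P^\perp DD^TU - W_1(U^TDZ+Z^TD^TU)\right](Z^TZ)^{-1},$$ $$W_3 = \left[P^\perp DD^TW_1 - W_2(U^TDZ+Z^TD^TU)-W_1(U^TDD^TU+W_1^TDZ+Z^TD^TW_1-W_1^TW_1Z^TZ)\right](Z^TZ)^{-1},$$ $$\begin{aligned}W_4=\big[&P^\perp DD^TW_2-W_3(U^TDZ+Z^TD^TU)-W_2(U^TDD^TU+W_1^TDZ+Z^TD^TW_1-W_1^TW_1Z^TZ)\\&-W_1(U^TDD^TW_1+W_1^TDD^TU+W_2^TDZ+Z^TD^TW_2-W_1^TW_2Z^TZ-W_2^TW_1Z^TZ\\&\qquad-W_1^TW_1U^TDZ-W_1^TW_1Z^TD^TU)\big](Z^TZ)^{-1}.\end{aligned}$$ Then $\mathcal{R}^{\mathrm{opt}}_X(D)=U_+Z_+^T$ with $U_+=\mathrm{orth}\big(U+\sum_{j=1}^pW_j\big)$ and $Z_+=(X+D)^TU_+$. Here $\mathrm{orth}(A)$, for $A\in\mathbb{R}^{m\times r}$ of full column rank, denotes a matrix $AG$ with $G\in\mathbb{R}^{r\times r}$ invertible and $(AG)^T(AG)=I$. *)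

theory Defs
  imports "HOL-Analysis.Analysis"
begin

text \<open>
  An \<open>m \<times> n\<close> real matrix has type \<^typ>\<open>real^'n^'m\<close>, and the rank \<open>r\<close> is \<open>CARD('r)\<close>, so that the
  factors of \<open>X = U Z\<^sup>T\<close> have types \<^typ>\<open>real^'r^'m\<close> and \<^typ>\<open>real^'r^'n\<close>. On such matrices
  \<^const>\<open>norm\<close> is the Euclidean norm of all entries, i.e. the Frobenius norm.
\<close>

notation transpose ("(_\<^sup>T)" [1000] 999)

definition fixed_rank :: "nat \<Rightarrow> (real^'n^'m) set" where
  "fixed_rank r = {X. rank X = r}"

text \<open>
  \<open>is_orth A B\<close> says that \<open>B\<close> is an orthonormalization of the columns of \<open>A\<close>. It is a relation because
  \<open>B\<close> is determined only up to an orthogonal factor on the right.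
\<close>

definition is_orth :: "real^'r^'m \<Rightarrow> real^'r^'m \<Rightarrow> bool" where
  "is_orth A B \<longleftrightarrow> (\<exists>G :: real^'r^'r. invertible G \<and> B = A ** G \<and> B\<^sup>T ** B = mat 1)"

definition proj_perp :: "real^'r^'m \<Rightarrow> real^'m^'m" where
  "proj_perp U = mat 1 - U ** U\<^sup>T"

definition opt_W1 :: "real^'r^'m \<Rightarrow> real^'r^'n \<Rightarrow> real^'n^'m \<Rightarrow> real^'r^'m" where
  "opt_W1 U Z D = proj_perp U ** D ** Z ** matrix_inv (Z\<^sup>T ** Z)"

definition opt_W2 :: "real^'r^'m \<Rightarrow> real^'r^'n \<Rightarrow> real^'n^'m \<Rightarrow> real^'r^'m" where
  "opt_W2 U Z D =
    (let W1 = opt_W1 U Z D in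
      (proj_perp U ** D ** D\<^sup>T ** U
        - W1 ** (U\<^sup>T ** D ** Z + Z\<^sup>T ** D\<^sup>T ** U))
      ** matrix_inv (Z\<^sup>T ** Z))"

definition opt_W3 :: "real^'r^'m \<Rightarrow> real^'r^'n \<Rightarrow> real^'n^'m \<Rightarrow> real^'r^'m" where
  "opt_W3 U Z D =
    (let W1 = opt_W1 U Z D; W2 = opt_W2 U Z D in
      (proj_perp U ** D ** D\<^sup>T ** W1
        - W2 ** (U\<^sup>T ** D ** Z + Z\<^sup>T ** D\<^sup>T ** U)
        - W1 ** (U\<^sup>T ** D ** D\<^sup>T ** U + W1\<^sup>T ** D ** Z + Z\<^sup>T ** D\<^sup>T ** W1
            - W1\<^sup>T ** W1 ** Z\<^sup>T ** Z))
      ** matrix_inv (Z\<^sup>T ** Z))"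

definition opt_W4 :: "real^'r^'m \<Rightarrow> real^'r^'n \<Rightarrow> real^'n^'m \<Rightarrow> real^'r^'m" where
  "opt_W4 U Z D =
    (let W1 = opt_W1 U Z D; W2 = opt_W2 U Z D; W3 = opt_W3 U Z D in
      (proj_perp U ** D ** D\<^sup>T ** W2
        - W3 ** (U\<^sup>T ** D ** Z + Z\<^sup>T ** D\<^sup>T ** U)
        - W2 ** (U\<^sup>T ** D ** D\<^sup>T ** U + W1\<^sup>T ** D ** Z + Z\<^sup>T ** D\<^sup>T ** W1
            - W1\<^sup>T ** W1 ** Z\<^sup>T ** Z)
        - W1 ** (U\<^sup>T ** D ** D\<^sup>T ** W1 + W1\<^sup>T ** D ** D\<^sup>T ** U
            + W2\<^sup>T ** D ** Z + Z\<^sup>T ** D\<^sup>T ** W2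
            - W1\<^sup>T ** W2 ** Z\<^sup>T ** Z - W2\<^sup>T ** W1 ** Z\<^sup>T ** Z
            - W1\<^sup>T ** W1 ** U\<^sup>T ** D ** Z - W1\<^sup>T ** W1 ** Z\<^sup>T ** D\<^sup>T ** U))
      ** matrix_inv (Z\<^sup>T ** Z))"

text \<open>The corrections are only given for \<open>1 \<le> j \<le> 4\<close>; the value \<open>0\<close> elsewhere is a dummy.\<close>

definition opt_W :: "nat \<Rightarrow> real^'r^'m \<Rightarrow> real^'r^'n \<Rightarrow> real^'n^'m \<Rightarrow> real^'r^'m" where
  "opt_W j U Z D =
    (if j = 1 then opt_W1 U Z D
     else if j = 2 then opt_W2 U Z D
     else if j = 3 then opt_W3 U Z D
     else if j = 4 then opt_W4 U Z D
     else 0)"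

text \<open>
  A map is an optimal perturbative retraction of order \<open>p\<close> if each of its values arises from some
  factorization \<open>X = U Z\<^sup>T\<close> and some choice of orthonormalization. The \<^term>\<open>TYPE('r)\<close> argument
  fixes the rank; nothing is required of the map off the rank-\<open>r\<close> manifold.
\<close>

definition optimal_perturbative_retraction ::
    "'r::finite itself \<Rightarrow> nat \<Rightarrow> (real^'n^'m \<Rightarrow> real^'n^'m \<Rightarrow> real^'n^'m) \<Rightarrow> bool" where
  "optimal_perturbative_retraction T p Ret \<longleftrightarrow>
    (\<forall>X \<in> fixed_rank CARD('r). \<forall>D.
      \<exists>(U :: real^'r^'m) (Z :: real^'r^'n) (Up :: real^'r^'m) (Zp :: real^'r^'n).
        X = U ** Z\<^sup>T \<and> U\<^sup>T ** U = mat 1 \<and> rank Z = CARD('r) \<and>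
        is_orth (U + (\<Sum>j=1..p. opt_W j U Z D)) Up \<and>
        Zp = (X + D)\<^sup>T ** Up \<and>
        Ret X D = Up ** Zp\<^sup>T)"

text \<open>
  \<open>gd_dork Ret dt L X0 j\<close> is the iterate \<open>X\<^sup>(\<^sup>j\<^sup>)\<close>; \<open>Ret j\<close> and \<open>L j\<close>, for \<open>j \<ge> 1\<close>, are the inner
  retraction and the time-averaged increment used in step \<open>j\<close>.
\<close>

fun gd_dork ::
    "(nat \<Rightarrow> real^'n^'m \<Rightarrow> real^'n^'m \<Rightarrow> real^'n^'m) \<Rightarrow> real \<Rightarrow> (nat \<Rightarrow> real^'n^'m)
      \<Rightarrow> real^'n^'m \<Rightarrow> nat \<Rightarrow> real^'n^'m" where
  "gd_dork Ret dt L X0 0 = X0"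
| "gd_dork Ret dt L X0 (Suc j) =
    Ret (Suc j) (gd_dork Ret dt L X0 j)
      (dt *\<^sub>R L (Suc j) - (gd_dork Ret dt L X0 j - X0))"

end

theory Submission
  imports Defs
begin

text \<open>
  An optimal perturbative retraction takes the right factor \<open>Z\<^sub>+ = (X + D)\<^sup>T U\<^sub>+\<close>, which is the
  best one for an orthonormal left factor \<open>U\<^sub>+\<close>: its value \<open>U\<^sub>+ U\<^sub>+\<^sup>T (X + D)\<close> is the orthogonal projection of \<open>X + D\<close>
  onto the matrices whose columns lie in the range of \<open>U\<^sub>+\<close>. An orthogonal projection does not
  increase the Frobenius norm (\<open>norm_projection_mult_le\<close>), hence neither does the retraction
  (\<open>norm_optimal_retraction_le\<close>).

  A gd-DORK step applies its retraction at \<open>X\<^sup>(\<^sup>j\<^sup>-\<^sup>1\<^sup>)\<close> to an increment from which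
  \<open>X\<^sup>(\<^sup>j\<^sup>-\<^sup>1\<^sup>) - X\<^sub>i\<close> has been subtracted. Base point and increment thus add up to
  \<open>X\<^sub>i + \<Delta>t L\<^sup>(\<^sup>j\<^sup>)\<close>, from which the previous iterate has cancelled, and the bound for the last step is the
  bound for the scheme.
\<close>

lemma inner_matrix_mult_left:
  fixes A :: "real^'k^'m" and B :: "real^'n^'k" and C :: "real^'n^'m"
  shows "inner (A ** B) C = inner B (A\<^sup>T ** C)"
proof -
  have "inner (A ** B) C = (\<Sum>i\<in>UNIV. \<Sum>j\<in>UNIV. \<Sum>l\<in>UNIV. A $ i $ l * B $ l $ j * C $ i $ j)"
    by (simp add: inner_vec_def matrix_matrix_mult_def sum_distrib_right)
  also have "\<dots> = (\<Sum>i\<in>UNIV. \<Sum>l\<in>UNIV. \<Sum>j\<in>UNIV. A $ i $ l * B $ l $ j * C $ i $ j)"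
    by (intro sum.cong refl sum.swap)
  also have "\<dots> = (\<Sum>l\<in>UNIV. \<Sum>i\<in>UNIV. \<Sum>j\<in>UNIV. A $ i $ l * B $ l $ j * C $ i $ j)"
    by (rule sum.swap)
  also have "\<dots> = (\<Sum>l\<in>UNIV. \<Sum>j\<in>UNIV. \<Sum>i\<in>UNIV. A $ i $ l * B $ l $ j * C $ i $ j)"
    by (intro sum.cong refl sum.swap)
  also have "\<dots> = inner B (A\<^sup>T ** C)"
    by (simp add: inner_vec_def matrix_matrix_mult_def transpose_def sum_distrib_left mult_ac)
  finally show ?thesis .
qed

text \<open>
  Since \<open>P\<close> is symmetric and idempotent, \<open>\<parallel>P M\<parallel>\<^sup>2 = \<langle>M, P P M\<rangle> = \<langle>M, P M\<rangle>\<close>, and the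
  Cauchy-Schwarz inequality leaves one factor \<open>\<parallel>P M\<parallel>\<close> to cancel.
\<close>

lemma norm_projection_mult_le:
  fixes P :: "real^'m^'m" and M :: "real^'n^'m"
  assumes "P\<^sup>T = P" and "P ** P = P"
  shows "norm (P ** M) \<le> norm M"
proof -
  have "norm (P ** M) * norm (P ** M) = inner (P ** M) (P ** M)"
    by (simp add: dot_square_norm power2_eq_square)
  also have "\<dots> = inner M (P ** M)"
    by (simp add: inner_matrix_mult_left assms matrix_mul_assoc)
  also have "\<dots> \<le> norm M * norm (P ** M)"
    by (rule norm_cauchy_schwarz)
  finally show ?thesis
    by (cases "P ** M = 0") simp_all
qed

lemma orthonormal_columns_projection:
  fixes U :: "real^'r^'m"
  assumes "U\<^sup>T ** U = mat 1"
  shows "(U ** U\<^sup>T)\<^sup>T = U ** U\<^sup>T" and "(U ** U\<^sup>T) ** (U ** U\<^sup>T) = U ** U\<^sup>T"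
proof -
  show "(U ** U\<^sup>T)\<^sup>T = U ** U\<^sup>T"
    by (simp add: matrix_transpose_mul)
  have "(U ** U\<^sup>T) ** (U ** U\<^sup>T) = U ** (U\<^sup>T ** U) ** U\<^sup>T"
    by (simp add: matrix_mul_assoc)
  then show "(U ** U\<^sup>T) ** (U ** U\<^sup>T) = U ** U\<^sup>T"
    by (simp add: assms)
qed

lemma norm_optimal_retraction_le:
  fixes X D :: "real^'n^'m"
  assumes "optimal_perturbative_retraction TYPE('r::finite) p R"
    and "X \<in> fixed_rank CARD('r)"
  shows "norm (R X D) \<le> norm (X + D)"
proof -
  obtain A Up :: "real^'r^'m" and Zp :: "real^'r^'n"
    where orth: "is_orth A Up" and Zp: "Zp = (X + D)\<^sup>T ** Up" and R: "R X D = Up ** Zp\<^sup>T"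
    using assms unfolding optimal_perturbative_retraction_def by metis
  have "Up\<^sup>T ** Up = mat 1"
    using orth by (auto simp: is_orth_def)
  moreover have "R X D = (Up ** Up\<^sup>T) ** (X + D)"
    by (simp add: R Zp matrix_transpose_mul matrix_mul_assoc)
  ultimately show ?thesis
    by (simp only: norm_projection_mult_le orthonormal_columns_projection)
qed

theorem lemma5p3:
  fixes Xi :: "real^'n^'m"
    and dt :: real
    and k p :: nat
    and L :: "nat \<Rightarrow> real^'n^'m"
    and Ret :: "nat \<Rightarrow> real^'n^'m \<Rightarrow> real^'n^'m \<Rightarrow> real^'n^'m"
  assumes "Xi \<in> fixed_rank CARD('r::finite)"
    and "k \<ge> 1"
    and "p \<in> {1, 2, 3, 4}"
    and "\<forall>j \<in> {1..<k}. gd_dork Ret dt L Xi j \<in> fixed_rank CARD('r)"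
    and "optimal_perturbative_retraction TYPE('r) p (Ret k)"
  shows "norm (gd_dork Ret dt L Xi k) \<le> norm (Xi + dt *\<^sub>R L k)"
proof -
  obtain j where k: "k = Suc j"
    using \<open>k \<ge> 1\<close> by (cases k) auto
  define X where "X = gd_dork Ret dt L Xi j"
  have "X \<in> fixed_rank CARD('r)"
    using assms(1,4) by (cases "j = 0") (auto simp: X_def k)
  then have "norm (Ret k X (dt *\<^sub>R L k - (X - Xi))) \<le> norm (X + (dt *\<^sub>R L k - (X - Xi)))"
    by (rule norm_optimal_retraction_le[OF assms(5)])
  also have "X + (dt *\<^sub>R L k - (X - Xi)) = Xi + dt *\<^sub>R L k"
    by simp
  finally show ?thesis
    by (simp add: k X_def)
qed

end
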